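(* Let $G=\{1,\dots,n\}$ be the finite set of groups of compatible platoons present at the intersection at time $t\in\mathbb{R}^+$, where each group $g\in G$ has passing time $t_g^p>0$ and deadline $t_g^d\in\mathbb{R}$. A schedule is an ordering $\sigma=(\sigma(1),\dots,\sigma(n))$ of $G$ (a permutation of $G$). Under $\sigma$ the groups are served one after the other, without idle time, starting at time $t$, so that the lateness of the group in position $k$ is $$\mathcal{L}_{\sigma(k)}^{\sigma}=\Big(t+\sum_{m=1}^{k}t_{\sigma(m)}^{p}\Big)-t_{\sigma(k)}^{d}.$$ Let $S$ be a schedule in which the groups are arranged in non-decreasing order of their deadlines, i.e. $t_{S(1)}^d\le t_{S(2)}^d\le\dots\le t_{S(n)}^d$. Then $S$ is optimal in minimizing the travel delay, i.e. the maximum lateness: for every schedule $\sigma$ of $G$, $$\max_{g\in G}\mathcal{L}_g^{S}\le\max_{g\in G}\mathcal{L}_g^{\sigma}.$$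
   Context: Setting: platoons of connected and automated vehicles approach a signal-free intersection. The intersection is treated as a single machine and the groups of compatible platoons as jobs, giving the single-machine scheduling problem $1||L_{\max}$ of minimizing the maximum lateness. The lateness of a job is its completion time minus its deadline. All groups in $G$ are available at time $t$. The travel delay of a schedule is by definition the maximum lateness. Platoon data. Let $\ell>0$ be the distance from the entry of the schedule zone to the entry of the merging zone (the conflict area). A platoon $j$ consists of $|A_j|\ge 1$ vehicles with time headway $t_j^h$. It enters the schedule zone with initial speed $v_j^0$, where $0<v_j^0\le v_{\max}$, and it travels a distance $d_j^*$ inside the merging zone. Here $v_{\max}$ is the speed limit applicable to its route, $u_{\max}>0$ is the maximal acceleration, and $t_c$ is a clearance time. - The earliest arrival time is $t_j^{a*}=\ell/v_{\max}$ if $v_j^0=v_{\max}$. If $v_j^0<v_{\max}$, it is $t_j^{a*}=\frac{v_{\max}-v_j^0}{u_{\max}}+\frac{\ell-d_j^s}{v_{\max}}$ with $d_j^s=\frac{v_{\max}^2-(v_j^0)^2}{2u_{\max}}$. The zone is assumed long enough that $d_j^s\le \ell$. - The crossing time is $t_j^{c*}=\frac{d_j^*}{v_{\max}}+(|A_j|-1)t_j^h+t_c$. - The passing time of the platoon is $t_j^p=t_j^{a*}+t_j^{c*}$. - The deadline of the platoon is $t_j^d=\frac{\ell}{v_j^0}+t_j^{c*}$. Groups. Two platoons are compatible if their paths through the merging zone do not conflict. The compatibility graph has the platoons as vertices and an edge between each pair of compatible platoons. The groups of compatible platoons are the maximal cliques of this graph. For a group $g$, the passing time and deadline are $t_g^p=\max_{j\in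 g}t_j^p$ and $t_g^d=\max_{j\in g}t_j^d$. *)

theory Defs
  imports Complex_Main
begin

section \<open>Single-machine schedules and lateness\<close>

text \<open>A schedule sends a position to the group served in that position; its values outside
  \<open>{1..card G}\<close> are irrelevant. For \<open>G = {1..n}\<close> it is a permutation of \<open>G\<close>.\<close>

definition is_schedule :: "'g set \<Rightarrow> (nat \<Rightarrow> 'g) \<Rightarrow> bool" where
  "is_schedule G \<sigma> \<longleftrightarrow> bij_betw \<sigma> {1..card G} G"

definition position :: "'g set \<Rightarrow> (nat \<Rightarrow> 'g) \<Rightarrow> 'g \<Rightarrow> nat" where
  "position G \<sigma> g = inv_into {1..card G} \<sigma> g"

definition completion_time ::
    "real \<Rightarrow> 'g set \<Rightarrow> ('g \<Rightarrow> real) \<Rightarrow> (nat \<Rightarrow> 'g) \<Rightarrow> 'g \<Rightarrow> real" where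
  "completion_time t G p \<sigma> g = t + (\<Sum>m = 1..position G \<sigma> g. p (\<sigma> m))"

definition lateness ::
    "real \<Rightarrow> 'g set \<Rightarrow> ('g \<Rightarrow> real) \<Rightarrow> ('g \<Rightarrow> real) \<Rightarrow> (nat \<Rightarrow> 'g) \<Rightarrow> 'g \<Rightarrow> real" where
  "lateness t G p d \<sigma> g = completion_time t G p \<sigma> g - d g"

lemma lateness_at_position:
  assumes "is_schedule G \<sigma>" "k \<in> {1..card G}"
  shows "lateness t G p d \<sigma> (\<sigma> k) = (t + (\<Sum>m = 1..k. p (\<sigma> m))) - d (\<sigma> k)"
proof -
  have "position G \<sigma> (\<sigma> k) = k"
    using assms unfolding is_schedule_def position_def bij_betw_def
    by (simp add: inv_into_f_f)
  then show ?thesis by (simp add: lateness_def completion_time_def)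
qed

definition travel_delay ::
    "real \<Rightarrow> 'g set \<Rightarrow> ('g \<Rightarrow> real) \<Rightarrow> ('g \<Rightarrow> real) \<Rightarrow> (nat \<Rightarrow> 'g) \<Rightarrow> real" where
  "travel_delay t G p d \<sigma> = Max (lateness t G p d \<sigma> ` G)"

definition deadline_ordered :: "'g set \<Rightarrow> ('g \<Rightarrow> real) \<Rightarrow> (nat \<Rightarrow> 'g) \<Rightarrow> bool" where
  "deadline_ordered G d \<sigma> \<longleftrightarrow> mono_on {1..card G} (\<lambda>k. d (\<sigma> k))"


section \<open>Platoons at an intersection\<close>

text \<open>Platoons are indexed by \<open>'j\<close>, routes are of type \<open>'r\<close>, vehicles of type \<open>'v\<close>.
  Which paths through the merging zone conflict is data of the intersection, as is the speed
  limit of each route.\<close>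

record ('j, 'r, 'v) intersection =
  platoons :: "'j set"
  route :: "'j \<Rightarrow> 'r"
  vehicles :: "'j \<Rightarrow> 'v set"
  headway :: "'j \<Rightarrow> real"
  init_speed :: "'j \<Rightarrow> real"
  merge_dist :: "'j \<Rightarrow> real"
  conflict :: "'r \<Rightarrow> 'r \<Rightarrow> bool"
  speed_limit :: "'r \<Rightarrow> real"
  zone_length :: real
  max_accel :: real
  clearance :: real

abbreviation vmax :: "('j, 'r, 'v) intersection \<Rightarrow> 'j \<Rightarrow> real" where
  "vmax X j \<equiv> speed_limit X (route X j)"

text \<open>Distance needed to accelerate from the initial speed to the speed limit.\<close>

definition accel_dist :: "('j, 'r, 'v) intersection \<Rightarrow> 'j \<Rightarrow> real" where
  "accel_dist X j = ((vmax X j)\<^sup>2 - (init_speed X j)\<^sup>2) / (2 * max_accel X)"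

definition valid_intersection :: "('j, 'r, 'v) intersection \<Rightarrow> bool" where
  "valid_intersection X \<longleftrightarrow>
     finite (platoons X) \<and> platoons X \<noteq> {} \<and>
     symp (conflict X) \<and>
     0 < zone_length X \<and> 0 < max_accel X \<and>
     (\<forall>j \<in> platoons X.
        finite (vehicles X j) \<and> card (vehicles X j) \<ge> 1 \<and>
        0 < init_speed X j \<and> init_speed X j \<le> vmax X j \<and>
        (init_speed X j < vmax X j \<longrightarrow> accel_dist X j \<le> zone_length X))"

definition arrival_time :: "('j, 'r, 'v) intersection \<Rightarrow> 'j \<Rightarrow> real" where
  "arrival_time X j =
     (if init_speed X j = vmax X j then zone_length X / vmax X j
      else (vmax X j - init_speed X j) / max_accel X
           + (zone_length X - accel_dist X j) / vmax X j)"

definition crossing_time :: "('j, 'r, 'v) intersection \<Rightarrow> 'j \<Rightarrow> real" where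
  "crossing_time X j =
     merge_dist X j / vmax X j + (real (card (vehicles X j)) - 1) * headway X j + clearance X"

definition platoon_passing_time :: "('j, 'r, 'v) intersection \<Rightarrow> 'j \<Rightarrow> real" where
  "platoon_passing_time X j = arrival_time X j + crossing_time X j"

definition platoon_deadline :: "('j, 'r, 'v) intersection \<Rightarrow> 'j \<Rightarrow> real" where
  "platoon_deadline X j = zone_length X / init_speed X j + crossing_time X j"

definition compatible :: "('j, 'r, 'v) intersection \<Rightarrow> 'j \<Rightarrow> 'j \<Rightarrow> bool" where
  "compatible X i j \<longleftrightarrow> \<not> conflict X (route X i) (route X j)"

text \<open>The compatibility graph has no loops, so only pairs of distinct platoons are constrained.\<close>

definition compatible_clique :: "('j, 'r, 'v) intersection \<Rightarrow> 'j set \<Rightarrow> bool" where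
  "compatible_clique X C \<longleftrightarrow>
     C \<subseteq> platoons X \<and> (\<forall>i \<in> C. \<forall>j \<in> C. i \<noteq> j \<longrightarrow> compatible X i j)"

definition groups :: "('j, 'r, 'v) intersection \<Rightarrow> 'j set set" where
  "groups X =
     {C. compatible_clique X C \<and> (\<forall>D. compatible_clique X D \<and> C \<subseteq> D \<longrightarrow> D = C)}"

definition group_passing_time :: "('j, 'r, 'v) intersection \<Rightarrow> 'j set \<Rightarrow> real" where
  "group_passing_time X g = Max (platoon_passing_time X ` g)"

definition group_deadline :: "('j, 'r, 'v) intersection \<Rightarrow> 'j set \<Rightarrow> real" where
  "group_deadline X g = Max (platoon_deadline X ` g)"

end

(* Let g be in position k of the deadline-ordered schedule S, and let h be the group that another
   schedule serves last among the first k groups of S. Then h completes there no earlier than g does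
   under S, while its deadline is at most that of g, so h is at least as late as g is under S. *)

theory Submission
  imports Defs
begin

text \<open>The type of groups is left arbitrary so that one exchange-free argument serves both the
  numbered groups \<open>{1..n}\<close> and the cliques in \<open>groups X\<close>.\<close>

lemma earliest_deadline_first_optimal:
  assumes fin: "finite G" and p: "\<forall>g \<in> G. 0 \<le> p g"
    and S: "is_schedule G S" and ord: "deadline_ordered G d S" and sig: "is_schedule G \<sigma>"
  shows "travel_delay t G p d S \<le> travel_delay t G p d \<sigma>"
proof (cases "G = {}")
  case True
  \<comment> \<open>Both sides are the same unspecified value \<open>Max {}\<close>.\<close>
  then show ?thesis by (simp add: travel_delay_def)
next
  case False
  \<comment> \<open>To compare the maxima, each lateness under \<open>S\<close> only has to be
    dominated by some lateness under \<open>\<sigma>\<close>; the witness \<open>h\<close> may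
    differ from \<open>g\<close>.\<close>
  have "\<exists>h \<in> G. lateness t G p d S g \<le> lateness t G p d \<sigma> h" if g: "g \<in> G" for g
  proof -
    have bijS: "bij_betw S {1..card G} G" and bij\<sigma>: "bij_betw \<sigma> {1..card G} G"
      using S sig by (auto simp: is_schedule_def)
    obtain k where k: "k \<in> {1..card G}" and gk: "g = S k"
      using g bij_betw_imp_surj_on[OF bijS] by blast
    define A where "A = S ` {1..k}"
    \<comment> \<open>\<open>I\<close> collects the positions that \<open>\<sigma>\<close> gives to
      the first \<open>k\<close> groups of \<open>S\<close>. Its maximum \<open>m\<close> yields the
      witness \<open>\<sigma> m\<close>.\<close>
    define I where "I = {i \<in> {1..card G}. \<sigma> i \<in> A}"
    define m where "m = Max I"
    have AG: "A \<subseteq> G" using bij_betw_imp_surj_on[OF bijS] k by (auto simp: A_def)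
    have "g \<in> A" using k gk by (auto simp: A_def)
    \<comment> \<open>The position of \<open>g\<close> under \<open>\<sigma>\<close> lies in
      \<open>I\<close>, so \<open>Max I\<close> is a genuine maximum.\<close>
    then have "I \<noteq> {}"
      using bij_betwE[OF bij_betw_inv_into[OF bij\<sigma>]] bij_betw_inv_into_right[OF bij\<sigma>] g
      by (fastforce simp: I_def)
    moreover have "finite I" by (simp add: I_def)
    ultimately have "m \<in> I" and max: "\<And>i. i \<in> I \<Longrightarrow> i \<le> m" by (auto simp: m_def)
    then have m: "m \<in> {1..card G}" and mA: "\<sigma> m \<in> A" by (auto simp: I_def)
    have AM: "A \<subseteq> \<sigma> ` {1..m}"
    proof
      fix a assume a: "a \<in> A"
      then obtain i where i: "i \<in> {1..card G}" "a = \<sigma> i"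
        using AG bij_betw_imp_surj_on[OF bij\<sigma>] by (metis imageE subsetD)
      then have "i \<le> m" using a by (intro max) (simp add: I_def)
      then show "a \<in> \<sigma> ` {1..m}" using i by auto
    qed
    have injS: "inj_on S {1..k}" and inj\<sigma>: "inj_on \<sigma> {1..m}"
      using k m by (auto intro: inj_on_subset[OF bij_betw_imp_inj_on[OF bijS]]
          inj_on_subset[OF bij_betw_imp_inj_on[OF bij\<sigma>]])
    have MG: "\<sigma> ` {1..m} \<subseteq> G" using bij_betw_imp_surj_on[OF bij\<sigma>] m by auto
    have "(\<Sum>i = 1..k. p (S i)) = sum p A"
      using injS by (simp add: A_def sum.reindex)
    \<comment> \<open>By the time \<open>\<sigma>\<close> has served position \<open>m\<close>, all
      of \<open>A\<close> is done; any further groups served by then add nonnegative time.\<close>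
    also have "\<dots> \<le> sum p (\<sigma> ` {1..m})"
      using AM MG p by (intro sum_mono2) auto
    also have "\<dots> = (\<Sum>i = 1..m. p (\<sigma> i))"
      using inj\<sigma> by (simp add: sum.reindex)
    finally have le: "(\<Sum>i = 1..k. p (S i)) \<le> (\<Sum>i = 1..m. p (\<sigma> i))" .
    obtain j where j: "j \<in> {1..k}" "\<sigma> m = S j" using mA by (auto simp: A_def)
    \<comment> \<open>As a member of \<open>A\<close>, \<open>\<sigma> m\<close> sits in
      \<open>S\<close> at a position \<open>j \<le> k\<close>, so the deadline order
      applies.\<close>
    have "d (\<sigma> m) \<le> d g"
      using mono_onD[OF ord[unfolded deadline_ordered_def], of j k] j k gk by simp
    then have "lateness t G p d S g \<le> lateness t G p d \<sigma> (\<sigma> m)"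
      using le lateness_at_position[OF S k] lateness_at_position[OF sig m] gk by simp
    then show ?thesis using mA AG by blast
  qed
  then show ?thesis
    using fin False unfolding travel_delay_def
    by (intro Max.boundedI) (auto simp: Max_ge_iff)
qed

lemma finite_groups: "finite (platoons X) \<Longrightarrow> finite (groups X)"
  by (rule finite_subset[of _ "Pow (platoons X)"]) (auto simp: groups_def compatible_clique_def)

theorem theorem1:
  fixes t :: real
  assumes "0 \<le> t"
  shows
    "(\<forall>(n::nat) (p :: nat \<Rightarrow> real) (d :: nat \<Rightarrow> real) S \<sigma>.
        1 \<le> n \<and> (\<forall>g \<in> {1..n}. 0 < p g) \<and>
        is_schedule {1..n} S \<and> deadline_ordered {1..n} d S \<and> is_schedule {1..n} \<sigma>
        \<longrightarrow> travel_delay t {1..n} p d S \<le> travel_delay t {1..n} p d \<sigma>)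
     \<and>
     (\<forall>(X :: ('j, 'r, 'v) intersection) S \<sigma>.
        valid_intersection X \<and> (\<forall>g \<in> groups X. 0 < group_passing_time X g) \<and>
        is_schedule (groups X) S \<and> deadline_ordered (groups X) (group_deadline X) S \<and>
        is_schedule (groups X) \<sigma>
        \<longrightarrow> travel_delay t (groups X) (group_passing_time X) (group_deadline X) S
            \<le> travel_delay t (groups X) (group_passing_time X) (group_deadline X) \<sigma>)"
proof (intro conjI allI impI; elim conjE)
  fix n :: nat and p d :: "nat \<Rightarrow> real" and S \<sigma>
  assume "\<forall>g \<in> {1..n}. 0 < p g" "is_schedule {1..n} S" "deadline_ordered {1..n} d S"
    "is_schedule {1..n} \<sigma>"
  then show "travel_delay t {1..n} p d S \<le> travel_delay t {1..n} p d \<sigma>"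
    by (intro earliest_deadline_first_optimal) (simp_all add: less_imp_le)
next
  fix X :: "('j, 'r, 'v) intersection" and S \<sigma>
  assume "valid_intersection X" "\<forall>g \<in> groups X. 0 < group_passing_time X g"
    "is_schedule (groups X) S" "deadline_ordered (groups X) (group_deadline X) S"
    "is_schedule (groups X) \<sigma>"
  then show "travel_delay t (groups X) (group_passing_time X) (group_deadline X) S
      \<le> travel_delay t (groups X) (group_passing_time X) (group_deadline X) \<sigma>"
    \<comment> \<open>Validity makes the set of platoons finite, and groups are subsets of it, so
      there are finitely many groups.\<close>
    by (intro earliest_deadline_first_optimal)
      (simp_all add: less_imp_le finite_groups valid_intersection_def)
qed

end
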